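(* Suppose that the condition "for every $q\ge1$, $\big\langle\big(\sup_{1\le i\le d}a(e_i)\big)^{-q}\big\rangle<\infty$" does not hold. Let $\tilde e\in\mathbb{B}$ be an edge such that $0\notin\tilde e$ (i.e. $0$ is not an endpoint of $\tilde e$), let $g=a(\tilde e)-\langle a(\tilde e)\rangle$, and let $u$ be the solution of $\partial_tu_t+D^*aDu_t=0$, $u_0=g$. Then $u$ does not satisfy the property $$\text{for every } p\ge1,\qquad \sup_{t\ge1}\,t^{\frac d2}\,\langle|u_t|^{2p}\rangle^{\frac1p}<\infty,$$ i.e. there exists $p\ge1$ for which this supremum is infinite.
   Context: Let $d>2$ be an integer, and let $(e_1,\dots,e_d)$ be the canonical basis of $\mathbb{Z}^d$. $\mathbb{B}$ is the set of unoriented nearest-neighbor edges of $\mathbb{Z}^d$ ($x\sim y$ iff $|x-y|=1$). For $e\in\mathbb{B}$, its endpoints are written $\underline e,\overline e$, with the convention $\overline e-\underline e = e_i$ for some $i\in\{1,\dots,d\}$; the vector $e_i$ is identified with the edge $(0,e_i)$. Let $\Omega=[0,1]^{\mathbb{B}}$; for $x\in\mathbb{Z}^d$ and $a=(a(e))_{e\in\mathbb{B}}\in\Omega$ let $\tau_x a=(a(x+e))_{e\in\mathbb{B}}$, where $x+e=(x+\underline e,x+\overline e)$. The environment $a=(a(e))_{e\in\mathbb{B}}$ is a random element of $\Omega$; $\langle\cdot\rangle$ denotes expectation with respect to its law (and $\mathbb{P}$ the probability). Standing assumptions: the random variables $(a(e))_{e\in\mathbb{B}}$ are independent, the law of $a(e)$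 depends only on the orientation of $e$ (so $\tau_x a$ has the same law as $a$), and $\mathbb{P}[a(e)=0]<1$ for every $e$. For $\xi:\Omega\to\mathbb{R}$, $D\xi=(D_1\xi,\dots,D_d\xi)$ with $D_i\xi(a)=\xi(\tau_{e_i}a)-\xi(a)$. The adjoint in $L^2(\Omega)$ is $D^*\xi=\sum_{i=1}^d D_i^*\xi_i$ for $\xi=(\xi_1,\dots,\xi_d)$, with $D_i^*\xi_i(a)=\xi_i(\tau_{-e_i}a)-\xi_i(a)$. The operator $D^*aD$ is $D^*aDu(a)=\sum_{i=1}^d D_i^*\big(a(e_i)D_iu\big)(a)$, i.e. $D^*aDu(a)=\sum_{y\sim 0}a((0,y))\,(u(a)-u(\tau_y a))$. *)

theory Defs
  imports "HOL-Probability.Probability"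
begin

definition bonds :: "(int ^ 'd) set set" where
  "bonds = {{x, y} | x y. (\<Sum>i\<in>UNIV. (x $ i - y $ i)\<^sup>2) = 1}"

definition bond :: "int ^ 'd \<Rightarrow> 'd \<Rightarrow> (int ^ 'd) set" where
  "bond x i = {x, x + axis i 1}"

text \<open>An environment is a function on \<^term>\<open>bonds\<close>, extended by \<^term>\<open>undefined\<close> to other sets
  of vertices, as in \<^const>\<open>PiM\<close>.\<close>

type_synonym 'd env = "(int ^ 'd) set \<Rightarrow> real"

definition env_space :: "'d::finite env measure" where
  "env_space = PiM bonds (\<lambda>_. restrict_space borel {0..1})"

definition translate :: "int ^ 'd \<Rightarrow> 'd env \<Rightarrow> 'd env" where
  "translate x a = (\<lambda>e\<in>bonds. a ((+) x ` e))"

locale random_environment = prob_space P for P :: "'d::finite env measure" +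
  assumes sets_env: "sets P = sets env_space"
    and indep_conductances: "indep_vars (\<lambda>_. borel) (\<lambda>e a. a e) bonds"
    and law_orientation: "distr P borel (\<lambda>a. a (bond x i)) = distr P borel (\<lambda>a. a (bond y i))"
    and not_ae_zero: "e \<in> bonds \<Longrightarrow> prob {a \<in> space P. a e = 0} < 1"

definition Dd :: "'d \<Rightarrow> ('d::finite env \<Rightarrow> real) \<Rightarrow> 'd env \<Rightarrow> real" where
  "Dd i \<xi> a = \<xi> (translate (axis i 1) a) - \<xi> a"

definition Dd_adj :: "'d \<Rightarrow> ('d::finite env \<Rightarrow> real) \<Rightarrow> 'd env \<Rightarrow> real" where
  "Dd_adj i \<xi> a = \<xi> (translate (- axis i 1) a) - \<xi> a"

definition DaD :: "('d::finite env \<Rightarrow> real) \<Rightarrow> 'd env \<Rightarrow> real" where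
  "DaD u a = (\<Sum>i\<in>UNIV. Dd_adj i (\<lambda>b. b (bond 0 i) * Dd i u b) a)"

text \<open>Solutions are taken in \<open>L\<^sup>2\<close> of the law \<open>P\<close>: the initial condition holds almost surely
  and the time derivative is the limit of difference quotients in \<open>L\<^sup>2\<close>. As \<^const>\<open>DaD\<close> is a bounded
  operator there, this determines \<open>u t\<close> almost surely for all \<open>t \<ge> 0\<close>. The values of \<open>u\<close>
  at negative times are irrelevant.\<close>

definition square_integrable :: "'a measure \<Rightarrow> ('a \<Rightarrow> real) \<Rightarrow> bool" where
  "square_integrable M f \<longleftrightarrow> f \<in> borel_measurable M \<and> integrable M (\<lambda>x. (f x)\<^sup>2)"

definition parabolic_solution ::
    "'d::finite env measure \<Rightarrow> ('d env \<Rightarrow> real) \<Rightarrow> (real \<Rightarrow> 'd env \<Rightarrow> real) \<Rightarrow> bool" where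
  "parabolic_solution P g u \<longleftrightarrow>
     (\<forall>t\<ge>0. square_integrable P (u t)) \<and>
     (AE a in P. u 0 a = g a) \<and>
     (\<forall>t\<ge>0. ((\<lambda>s. \<integral>\<^sup>+ a. ennreal (((u s a - u t a) / (s - t) + DaD (u t) a)\<^sup>2) \<partial>P) \<longlongrightarrow> 0)
              (at t within {0..}))"

text \<open>Real powers on \<open>[0, \<infinity>]\<close>, with \<open>0\<close> and \<open>\<infinity>\<close> exchanged by negative exponents.\<close>

definition ennreal_powr :: "ennreal \<Rightarrow> real \<Rightarrow> ennreal" where
  "ennreal_powr x r =
     (if r = 0 then 1
      else if x = 0 then (if r < 0 then \<infinity> else 0)
      else if x = \<infinity> then (if r < 0 then 0 else \<infinity>)
      else ennreal (enn2real x powr r))"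

end

theory Submission
  imports Defs
begin

text \<open>
  A region of very small conductances around the origin is a trap: the random walk started at the
  origin stays there, and the solution \<open>u\<close> keeps its initial value for a long time. If some
  negative moment of the largest conductance \<open>s\<close> among the bonds \<open>(0, e\<^sub>i)\<close> is infinite, then
  traps are not rare enough for high moments of \<open>u\<close> to decay.

  Quantitatively, if the moment of order \<open>- q\<close> is infinite, then \<open>P (s \<le> \<delta>) > \<delta> powr (q + 1)\<close>
  for arbitrarily small \<open>\<delta> = 2 powr - n\<close> (\<open>small_ball_of_infinite_negative_moment\<close>). By
  independence and stationarity, all \<open>2 d\<close> bonds at the origin are at most \<open>\<delta>\<close> with the square
  of this probability, and independently of \<open>a e\<close> (\<open>prob_star_inter\<close>). Moreover \<open>a e\<close> exceeds its
  mean by some \<open>2 \<epsilon>\<close> with positive probability (\<open>conductance_exceeds_mean\<close>). On the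
  intersection \<open>u t \<ge> 2 \<epsilon> - 4 d \<delta> t\<close> (\<open>solution_ge_initial\<close>), which is at least \<open>\<epsilon>\<close> for
  \<open>t = \<epsilon> / (4 d \<delta>)\<close>. Hence the moment of \<open>u t\<close> of order \<open>2 p\<close>, to the power \<open>1 / p\<close>, is at
  least a constant times \<open>t powr (- 2 (q + 1) / p)\<close>, and a large \<open>p\<close> makes this decay slower than
  \<open>t powr (- d / 2)\<close>.

  The bound \<open>\<bar>u\<bar> \<le> 1\<close> needed for \<open>solution_ge_initial\<close> is a maximum principle. As the equation
  holds only in \<open>L\<^sup>2\<close>, both results are derived from one comparison lemma (\<open>L2_comparison\<close>), by
  controlling the integral of the squared positive part.
\<close>

section \<open>Comparison for curves of square-integrable functions\<close>

lemma square_integrable_measurable [measurable_dest]: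
  "square_integrable M f \<Longrightarrow> f \<in> borel_measurable M"
  by (simp add: square_integrable_def)

lemma square_integrable_mult:
  assumes "square_integrable M f" "square_integrable M g"
  shows "integrable M (\<lambda>x. f x * g x)"
proof (rule Bochner_Integration.integrable_bound)
  show "integrable M (\<lambda>x. (f x)\<^sup>2 + (g x)\<^sup>2)"
    using assms by (auto simp: square_integrable_def)
  show "(\<lambda>x. f x * g x) \<in> borel_measurable M"
    using assms by (auto simp: square_integrable_def)
  have "\<bar>x * y\<bar> \<le> x\<^sup>2 + y\<^sup>2" for x y :: real
  proof -
    have "0 \<le> \<bar>x\<bar> * \<bar>y\<bar>" by simp
    then show ?thesis
      using sum_squares_bound[of "\<bar>x\<bar>" "\<bar>y\<bar>"] unfolding abs_mult power2_abs by linarith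
  qed
  then show "AE x in M. norm (f x * g x) \<le> norm ((f x)\<^sup>2 + (g x)\<^sup>2)"
    by (intro AE_I2) (simp add: add_nonneg_nonneg)
qed

lemma square_integrable_bound:
  assumes "square_integrable M g" "f \<in> borel_measurable M"
    and "\<And>x. x \<in> space M \<Longrightarrow> \<bar>f x\<bar> \<le> \<bar>g x\<bar>"
  shows "square_integrable M f"
  unfolding square_integrable_def
proof
  show "integrable M (\<lambda>x. (f x)\<^sup>2)"
    by (rule Bochner_Integration.integrable_bound[of M "\<lambda>x. (g x)\<^sup>2"])
       (use assms in \<open>auto simp: square_integrable_def abs_le_square_iff\<close>)
qed fact

lemma square_integrable_add:
  assumes "square_integrable M f" "square_integrable M g"
  shows "square_integrable M (\<lambda>x. f x + g x)"
  using assms square_integrable_mult[OF assms]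
  by (auto simp: square_integrable_def power2_sum mult.assoc)

lemma square_integrable_cmult:
  assumes "square_integrable M f"
  shows "square_integrable M (\<lambda>x. c * f x)"
  using assms by (auto simp: square_integrable_def power_mult_distrib)

lemma square_integrable_diff:
  assumes "square_integrable M f" "square_integrable M g"
  shows "square_integrable M (\<lambda>x. f x - g x)"
  using square_integrable_add[OF assms(1) square_integrable_cmult[OF assms(2), of "-1"]] by simp

lemma square_integrable_sum:
  assumes "finite I" "\<And>i. i \<in> I \<Longrightarrow> square_integrable M (f i)"
  shows "square_integrable M (\<lambda>x. \<Sum>i\<in>I. f i x)"
  using assms
proof (induction I rule: finite_induct)
  case empty
  then show ?case by (simp add: square_integrable_def)
qed (auto intro: square_integrable_add)

lemma square_integrable_cong:
  assumes "\<And>x. x \<in> space M \<Longrightarrow> f x = g x"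
  shows "square_integrable M f \<longleftrightarrow> square_integrable M g"
  unfolding square_integrable_def
  using assms by (auto cong: measurable_cong Bochner_Integration.integrable_cong)

text \<open>The square of the positive part is once differentiable with a Lipschitz derivative, so its
  first-order Taylor remainder is at most quadratic. This is what lets an \<open>L\<^sup>2\<close> derivative pass
  through it, although its second derivative jumps at the origin.\<close>

lemma square_positive_part_taylor:
  fixes x y :: real
  shows "\<bar>(max 0 y)\<^sup>2 - (max 0 x)\<^sup>2 - 2 * max 0 x * (y - x)\<bar> \<le> (y - x)\<^sup>2"
proof (cases "x \<ge> 0"; cases "y \<ge> 0")
  assume "x \<ge> 0" "y \<ge> 0"
  then have "(max 0 y)\<^sup>2 - (max 0 x)\<^sup>2 - 2 * max 0 x * (y - x) = (y - x)\<^sup>2"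
    by (simp add: power2_eq_square algebra_simps)
  then show ?thesis by simp
next
  assume "x \<ge> 0" "\<not> y \<ge> 0"
  then have "x * y \<le> 0" by (simp add: mult_nonneg_nonpos)
  moreover have "0 \<le> y * y" "0 \<le> x * x" by simp_all
  moreover have "(max 0 y)\<^sup>2 - (max 0 x)\<^sup>2 - 2 * max 0 x * (y - x) = x * x - 2 * (x * y)"
    using \<open>x \<ge> 0\<close> \<open>\<not> y \<ge> 0\<close> by (simp add: power2_eq_square algebra_simps max_def)
  moreover have "(y - x)\<^sup>2 = x * x - 2 * (x * y) + y * y"
    by (simp add: power2_eq_square algebra_simps)
  ultimately show ?thesis by linarith
next
  assume "\<not> x \<ge> 0" "y \<ge> 0"
  then have "y\<^sup>2 \<le> (y - x)\<^sup>2" by (intro power_mono) auto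
  then show ?thesis using \<open>\<not> x \<ge> 0\<close> \<open>y \<ge> 0\<close> by (simp add: max_def)
qed (simp add: max_def)

text \<open>The cross term \<open>2 x\<^sub>+ r\<close> is split by Young's inequality with a free weight \<open>\<eta>\<close>; choosing
  \<open>\<eta>\<close> after integration replaces an appeal to the Cauchy-Schwarz inequality.\<close>

lemma difference_quotient_square_positive_part:
  fixes x y h \<zeta> \<eta> :: real
  assumes "h \<noteq> 0" "\<eta> > 0"
  defines "r \<equiv> (y - x) / h - \<zeta>"
  shows "\<bar>((max 0 y)\<^sup>2 - (max 0 x)\<^sup>2) / h - 2 * (max 0 x * \<zeta>)\<bar>
    \<le> \<eta> * (max 0 x)\<^sup>2 + r\<^sup>2 / \<eta> + \<bar>h\<bar> * (2 * \<zeta>\<^sup>2 + 2 * r\<^sup>2)"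
proof -
  have yx: "y - x = h * (\<zeta> + r)"
    using assms(1) by (simp add: r_def)
  define q where "q = (max 0 y)\<^sup>2 - (max 0 x)\<^sup>2 - 2 * max 0 x * (y - x)"
  have "((max 0 y)\<^sup>2 - (max 0 x)\<^sup>2) / h - 2 * (max 0 x * \<zeta>) = q / h + 2 * max 0 x * r"
    using assms(1) unfolding q_def yx by (simp add: field_simps)
  also have "\<bar>\<dots>\<bar> \<le> \<bar>q\<bar> / \<bar>h\<bar> + 2 * max 0 x * \<bar>r\<bar>"
    by (rule order_trans[OF abs_triangle_ineq]) (simp add: abs_mult)
  also have "\<bar>q\<bar> / \<bar>h\<bar> \<le> (h * (\<zeta> + r))\<^sup>2 / \<bar>h\<bar>"
    using square_positive_part_taylor[of y x] unfolding q_def yx by (intro divide_right_mono) auto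
  also have "\<dots> = \<bar>h\<bar> * (\<zeta> + r)\<^sup>2"
  proof -
    have "h\<^sup>2 = \<bar>h\<bar> * \<bar>h\<bar>" by (simp add: power2_eq_square)
    then show ?thesis
      using assms(1) unfolding power_mult_distrib by (simp only: mult.assoc nonzero_mult_div_cancel_left abs_eq_0 simp_thms)
  qed
  also have "\<dots> \<le> \<bar>h\<bar> * (2 * \<zeta>\<^sup>2 + 2 * r\<^sup>2)"
    using sum_squares_bound[of \<zeta> r] by (intro mult_left_mono) (auto simp: power2_sum)
  also have "2 * max 0 x * \<bar>r\<bar> \<le> \<eta> * (max 0 x)\<^sup>2 + r\<^sup>2 / \<eta>"
  proof -
    have "0 \<le> (\<eta> * max 0 x - \<bar>r\<bar>)\<^sup>2 / \<eta>" using assms(2) by simp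
    also have "\<dots> = \<eta> * (max 0 x)\<^sup>2 + r\<^sup>2 / \<eta> - 2 * max 0 x * \<bar>r\<bar>"
      using assms(2) by (simp add: power2_diff power_mult_distrib field_simps) (simp add: power2_eq_square)
    finally show ?thesis by simp
  qed
  finally show ?thesis by simp
qed

lemma has_derivative_integral_square_positive_part:
  fixes w :: "real \<Rightarrow> 'a \<Rightarrow> real" and z :: "'a \<Rightarrow> real"
  assumes w: "\<And>t. t \<in> T \<Longrightarrow> square_integrable M (w t)"
    and z: "square_integrable M z" and t: "t \<in> T"
    and deriv: "((\<lambda>s. \<integral>\<^sup>+a. ennreal (((w s a - w t a) / (s - t) - z a)\<^sup>2) \<partial>M) \<longlongrightarrow> 0)
      (at t within T)"
  shows "((\<lambda>s. \<integral>a. (max 0 (w s a))\<^sup>2 \<partial>M) has_real_derivative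
      2 * (\<integral>a. max 0 (w t a) * z a \<partial>M)) (at t within T)"
proof -
  define \<phi> where "\<phi> s = (\<integral>a. (max 0 (w s a))\<^sup>2 \<partial>M)" for s
  define r where "r s a = (w s a - w t a) / (s - t) - z a" for s a
  define R where "R s = (\<integral>a. (r s a)\<^sup>2 \<partial>M)" for s
  have r: "square_integrable M (r s)" if "s \<in> T" for s
    unfolding r_def
    using square_integrable_diff[OF square_integrable_cmult[OF square_integrable_diff[OF w[OF that] w[OF t]], of "1 / (s - t)"] z]
    by simp
  have pos: "square_integrable M (\<lambda>a. max 0 (w s a))" if "s \<in> T" for s
    by (rule square_integrable_bound[OF w[OF that]]) (use w[OF that] in \<open>auto simp: square_integrable_def\<close>)
  have ev: "\<forall>\<^sub>F s in at t within T. s \<in> T \<and> s \<noteq> t"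
    by (simp add: eventually_at_filter)
  have "((\<lambda>s. ennreal (R s)) \<longlongrightarrow> ennreal 0) (at t within T)"
  proof (rule Lim_transform_eventually)
    show "((\<lambda>s. \<integral>\<^sup>+a. ennreal ((r s a)\<^sup>2) \<partial>M) \<longlongrightarrow> ennreal 0) (at t within T)"
      using deriv by (simp add: r_def)
    show "\<forall>\<^sub>F s in at t within T. (\<integral>\<^sup>+a. ennreal ((r s a)\<^sup>2) \<partial>M) = ennreal (R s)"
      using ev
    proof eventually_elim
      case (elim s)
      then show ?case
        using r[of s] unfolding R_def square_integrable_def by (intro nn_integral_eq_integral) auto
    qed
  qed
  then have R0: "(R \<longlongrightarrow> 0) (at t within T)"
    by (rule tendsto_ennrealD) (auto simp: R_def)
  define B where "B s = (sqrt (R s) + \<bar>s - t\<bar>) * \<phi> t + sqrt (R s)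
      + \<bar>s - t\<bar> * (2 * (\<integral>a. (z a)\<^sup>2 \<partial>M) + 2 * R s)" for s
  have B0: "(B \<longlongrightarrow> (sqrt 0 + \<bar>t - t\<bar>) * \<phi> t + sqrt 0 + \<bar>t - t\<bar> * (2 * (\<integral>a. (z a)\<^sup>2 \<partial>M) + 2 * 0)) (at t within T)"
    unfolding B_def by (intro tendsto_intros R0)
  have "((\<lambda>s. (\<phi> s - \<phi> t) / (s - t) - 2 * (\<integral>a. max 0 (w t a) * z a \<partial>M)) \<longlongrightarrow> 0) (at t within T)"
  proof (rule Lim_null_comparison)
    show "(B \<longlongrightarrow> 0) (at t within T)" using B0 by simp
    show "\<forall>\<^sub>F s in at t within T.
      norm ((\<phi> s - \<phi> t) / (s - t) - 2 * (\<integral>a. max 0 (w t a) * z a \<partial>M)) \<le> B s"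
      using ev
    proof eventually_elim
      case (elim s)
      define h where "h = s - t"
      \<comment> \<open>The optimal weight is of order \<open>sqrt (R s)\<close>; the summand \<open>\<bar>h\<bar>\<close> only keeps it positive.\<close>
      define \<eta> where "\<eta> = sqrt (R s) + \<bar>h\<bar>"
      have h: "h \<noteq> 0" using elim by (simp add: h_def)
      have R_nn: "R s \<ge> 0" by (simp add: R_def)
      then have \<eta>: "\<eta> > 0" using h by (simp add: \<eta>_def add_nonneg_pos)
      note int = pos[of s] pos[OF t] r[of s] z square_integrable_mult[OF pos[OF t] z]
      have int_sq: "integrable M (\<lambda>a. (max 0 (w s a))\<^sup>2)" "integrable M (\<lambda>a. (max 0 (w t a))\<^sup>2)"
        "integrable M (\<lambda>a. (r s a)\<^sup>2)" "integrable M (\<lambda>a. (z a)\<^sup>2)"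
        using int elim by (auto simp: square_integrable_def)
      have R_\<eta>: "R s / \<eta> \<le> sqrt (R s)"
      proof -
        have "R s = sqrt (R s) * sqrt (R s)" using R_nn by simp
        also have "\<dots> \<le> sqrt (R s) * \<eta>" using R_nn by (intro mult_left_mono) (auto simp: \<eta>_def)
        finally show ?thesis using \<eta> by (simp add: field_simps)
      qed
      have bound: "\<bar>((max 0 (w s a))\<^sup>2 - (max 0 (w t a))\<^sup>2) / h - 2 * (max 0 (w t a) * z a)\<bar>
          \<le> \<eta> * (max 0 (w t a))\<^sup>2 + (r s a)\<^sup>2 / \<eta> + \<bar>h\<bar> * (2 * (z a)\<^sup>2 + 2 * (r s a)\<^sup>2)" for a
        using difference_quotient_square_positive_part[OF h \<eta>, of "w s a" "w t a" "z a"]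
        by (simp only: r_def h_def)
      have int_q: "integrable M (\<lambda>a. \<bar>((max 0 (w s a))\<^sup>2 - (max 0 (w t a))\<^sup>2) / h - 2 * (max 0 (w t a) * z a)\<bar>)"
        using int(5) int_sq by simp
      have int_bound: "integrable M (\<lambda>a. \<eta> * (max 0 (w t a))\<^sup>2 + (r s a)\<^sup>2 / \<eta> + \<bar>h\<bar> * (2 * (z a)\<^sup>2 + 2 * (r s a)\<^sup>2))"
        using int_sq by simp
      have "\<bar>(\<phi> s - \<phi> t) / h - 2 * (\<integral>a. max 0 (w t a) * z a \<partial>M)\<bar>
        = \<bar>\<integral>a. ((max 0 (w s a))\<^sup>2 - (max 0 (w t a))\<^sup>2) / h - 2 * (max 0 (w t a) * z a) \<partial>M\<bar>"
        using int(5) int_sq by (simp add: \<phi>_def)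
      also have "\<dots> \<le> (\<integral>a. \<bar>((max 0 (w s a))\<^sup>2 - (max 0 (w t a))\<^sup>2) / h - 2 * (max 0 (w t a) * z a)\<bar> \<partial>M)"
        by (rule integral_abs_bound)
      also have "\<dots> \<le> (\<integral>a. \<eta> * (max 0 (w t a))\<^sup>2 + (r s a)\<^sup>2 / \<eta> + \<bar>h\<bar> * (2 * (z a)\<^sup>2 + 2 * (r s a)\<^sup>2) \<partial>M)"
        using int_q int_bound bound by (rule integral_mono)
      also have "\<dots> = \<eta> * \<phi> t + R s / \<eta> + \<bar>h\<bar> * (2 * (\<integral>a. (z a)\<^sup>2 \<partial>M) + 2 * R s)"
        unfolding \<phi>_def R_def using int_sq by simp
      finally show ?case using R_\<eta> by (simp add: B_def \<eta>_def h_def)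
    qed
  qed
  then show ?thesis
    by (simp add: has_field_derivative_iff \<phi>_def Lim_null[symmetric] LIM_zero_iff)
qed

text \<open>A maximum principle for curves in \<open>L\<^sup>2\<close> with derivative \<open>z\<close>: by the growth condition,
  \<open>\<phi> t = \<integral> (w t)\<^sub>+\<^sup>2\<close> satisfies \<open>\<phi>' \<le> 2 C \<phi>\<close>, and \<open>\<phi> 0 = 0\<close>, so Gronwall's argument
  gives \<open>\<phi> = 0\<close>. All pointwise information about solutions is extracted from this lemma: the
  equation itself only holds in \<open>L\<^sup>2\<close>.\<close>

lemma L2_comparison:
  fixes w z :: "real \<Rightarrow> 'a \<Rightarrow> real"
  assumes w: "\<And>t. t \<ge> 0 \<Longrightarrow> square_integrable M (w t)"
    and z: "\<And>t. t \<ge> 0 \<Longrightarrow> square_integrable M (z t)"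
    and deriv: "\<And>t. t \<ge> 0 \<Longrightarrow>
      ((\<lambda>s. \<integral>\<^sup>+a. ennreal (((w s a - w t a) / (s - t) - z t a)\<^sup>2) \<partial>M) \<longlongrightarrow> 0) (at t within {0..})"
    and init: "AE a in M. w 0 a \<le> 0"
    and growth: "\<And>t. t \<ge> 0 \<Longrightarrow>
      (\<integral>a. max 0 (w t a) * z t a \<partial>M) \<le> C * (\<integral>a. (max 0 (w t a))\<^sup>2 \<partial>M)"
    and "t \<ge> 0"
  shows "AE a in M. w t a \<le> 0"
proof -
  define \<phi> where "\<phi> s = (\<integral>a. (max 0 (w s a))\<^sup>2 \<partial>M)" for s
  have \<phi>': "(\<phi> has_real_derivative 2 * (\<integral>a. max 0 (w s a) * z s a \<partial>M)) (at s within {0..})"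
    if "s \<ge> 0" for s
    unfolding \<phi>_def
    by (rule has_derivative_integral_square_positive_part[OF w z _ deriv]) (use that in auto)
  have E': "((\<lambda>s. exp (- 2 * C * s) * \<phi> s) has_real_derivative
      exp (- 2 * C * s) * (2 * (\<integral>a. max 0 (w s a) * z s a \<partial>M) - 2 * C * \<phi> s)) (at s within {0..})"
    if "s \<ge> 0" for s
    by (rule derivative_eq_intros \<phi>'[OF that] refl)+ (simp add: algebra_simps)
  have "exp (- 2 * C * 0) * \<phi> 0 \<ge> exp (- 2 * C * t) * \<phi> t"
  proof (rule DERIV_nonpos_imp_decreasing_open[OF \<open>t \<ge> 0\<close>])
    fix s assume s: "0 < s" "s < t"
    have "at s within {0..} = at s"
      using s by (intro at_within_interior) (simp add: interior_Ici[of "- 1"] )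
    then show "\<exists>y. ((\<lambda>s. exp (- 2 * C * s) * \<phi> s) has_real_derivative y) (at s) \<and> y \<le> 0"
      using E'[of s] growth[of s] s
      by (intro exI conjI) (auto simp: \<phi>_def mult_le_0_iff)
  next
    have "continuous_on {0..} (\<lambda>s. exp (- 2 * C * s) * \<phi> s)"
      by (rule DERIV_continuous_on[OF E']) auto
    then show "continuous_on {0..t} (\<lambda>s. exp (- 2 * C * s) * \<phi> s)"
      by (rule continuous_on_subset) auto
  qed
  moreover have "\<phi> 0 = 0"
    unfolding \<phi>_def by (rule integral_eq_zero_AE) (use init in auto)
  ultimately have "\<phi> t \<le> 0"
    by (simp add: mult_le_0_iff)
  then have "\<phi> t = 0"
    by (simp add: \<phi>_def order_antisym)
  moreover have int: "integrable M (\<lambda>a. (max 0 (w t a))\<^sup>2)"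
  proof -
    have "square_integrable M (\<lambda>a. max 0 (w t a))"
      by (rule square_integrable_bound[OF w[OF \<open>t \<ge> 0\<close>]])
         (use w[OF \<open>t \<ge> 0\<close>] in \<open>auto simp: square_integrable_def\<close>)
    then show ?thesis by (simp add: square_integrable_def)
  qed
  ultimately have "AE a in M. (max 0 (w t a))\<^sup>2 = 0"
    using integral_nonneg_eq_0_iff_AE[OF int] by (simp add: \<phi>_def)
  then show ?thesis
    by eventually_elim (simp add: max_def split: if_splits)
qed

section \<open>Bonds and stationarity of the environment\<close>

lemma bond_mem_bonds: "bond x i \<in> (bonds :: (int ^ 'd::finite) set set)"
proof -
  have "(\<Sum>j\<in>UNIV. (x $ j - (x + axis i 1) $ j)\<^sup>2) = (\<Sum>j\<in>UNIV. if j = i then 1 else 0)"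
    by (rule sum.cong) (auto simp: axis_def)
  then show ?thesis
    unfolding bonds_def bond_def by (simp only: sum.delta finite UNIV_I if_True) blast
qed

lemma bonds_cases:
  fixes e :: "(int ^ 'd::finite) set"
  assumes "e \<in> bonds"
  obtains x i where "e = bond x i"
proof -
  obtain x y where e: "e = {x, y}" and xy: "(\<Sum>j\<in>UNIV. (x $ j - y $ j)\<^sup>2) = 1"
    using assms unfolding bonds_def by blast
  obtain i where i: "x $ i \<noteq> y $ i"
    using xy by fastforce
  have split: "(x $ i - y $ i)\<^sup>2 + (\<Sum>j\<in>UNIV - {i}. (x $ j - y $ j)\<^sup>2) = 1"
    using xy by (simp add: sum.remove[of UNIV i])
  have "(x $ i - y $ i)\<^sup>2 > 0"
    using i by simp
  moreover have "(\<Sum>j\<in>UNIV - {i}. (x $ j - y $ j)\<^sup>2) \<ge> 0"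
    by (simp add: sum_nonneg)
  ultimately have one: "(x $ i - y $ i)\<^sup>2 = 1" and rest: "(\<Sum>j\<in>UNIV - {i}. (x $ j - y $ j)\<^sup>2) = 0"
    using split by linarith+
  have eq: "x $ j = y $ j" if "j \<noteq> i" for j
    using rest that by (subst (asm) sum_nonneg_eq_0_iff) auto
  from one consider "y $ i = x $ i + 1" | "x $ i = y $ i + 1"
    unfolding power2_eq_1_iff by linarith
  then show thesis
  proof cases
    case 1
    then have "y = x + axis i 1"
      using eq by (auto simp: vec_eq_iff axis_def)
    then show thesis using that[of x i] by (simp add: e bond_def)
  next
    case 2
    then have "x = y + axis i 1"
      using eq by (auto simp: vec_eq_iff axis_def)
    then show thesis using that[of y i] by (simp add: e bond_def insert_commute)
  qed
qed

lemma image_plus_bond: "(+) x ` bond y i = bond (x + y) i"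
  by (simp add: bond_def add.assoc)

lemma image_plus_mem_bonds:
  fixes e :: "(int ^ 'd::finite) set"
  shows "e \<in> bonds \<Longrightarrow> (+) x ` e \<in> bonds"
  by (elim bonds_cases) (simp add: image_plus_bond bond_mem_bonds)

lemma inj_image_plus: "inj (\<lambda>e :: (int ^ 'd::finite) set. (+) x ` e)"
  by (rule injI) (simp add: inj_image_eq_iff)

abbreviation conductance_space :: "real measure" where
  "conductance_space \<equiv> restrict_space borel {0..1}"

lemma sets_conductance_space: "A \<in> sets conductance_space \<Longrightarrow> A \<in> sets borel"
  by (auto simp: sets_restrict_space_iff)

context random_environment
begin

lemma space_env: "space P = bonds \<rightarrow>\<^sub>E {0..1}"
  using sets_eq_imp_space_eq[OF sets_env] by (simp add: env_space_def space_PiM)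

lemma conductance_bounds:
  assumes "a \<in> space P" "e \<in> bonds"
  shows "0 \<le> a e" "a e \<le> 1"
  using assms by (auto simp: space_env PiE_iff)

lemma conductance_measurable':
  assumes "e \<in> bonds"
  shows "(\<lambda>a. a e) \<in> measurable P conductance_space"
  using measurable_component_singleton[OF assms, of "\<lambda>_. conductance_space"]
  by (simp add: measurable_cong_sets[OF sets_env refl] env_space_def)

lemma conductance_measurable:
  assumes "e \<in> bonds"
  shows "(\<lambda>a. a e) \<in> borel_measurable P"
  using conductance_measurable'[OF assms] by (auto simp: measurable_restrict_space2_iff)

lemma conductance_integrable:
  assumes "e \<in> bonds"
  shows "integrable P (\<lambda>a. a e)"
  by (rule integrable_const_bound[where B = 1])
     (use assms conductance_bounds in \<open>auto intro!: conductance_measurable AE_I2\<close>)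

lemma prob_conductance_eq:
  assumes "B \<in> sets borel"
  shows "prob {a \<in> space P. a (bond x i) \<in> B} = prob {a \<in> space P. a (bond y i) \<in> B}"
proof -
  have "measure (distr P borel (\<lambda>a. a (bond z i))) B = prob {a \<in> space P. a (bond z i) \<in> B}" for z
    using assms conductance_measurable[OF bond_mem_bonds, of z i]
    by (subst measure_distr) (auto intro: arg_cong[where f = prob])
  then show ?thesis
    using law_orientation[of x i y] by metis
qed

text \<open>Independence of the coordinates says that the joint law is a product measure. The given
  independence is with respect to the Borel sets of the line, and it is first transferred to the
  smaller interval, so that the product lives on the environment space itself.\<close>

lemma env_eq_PiM: "P = PiM bonds (\<lambda>e. distr P conductance_space (\<lambda>a. a e))"
proof -
  have "indep_vars (\<lambda>_. conductance_space) (\<lambda>e a. a e) bonds"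
    unfolding indep_vars_def2
  proof (intro conjI ballI)
    show "indep_sets (\<lambda>e. {(\<lambda>a. a e) -` A \<inter> space P |A. A \<in> sets conductance_space}) bonds"
      using indep_conductances unfolding indep_vars_def2
      by (elim conjE indep_sets_mono_sets) (use sets_conductance_space in blast)
  qed (rule conductance_measurable')
  moreover have "(bonds :: (int ^ 'd) set set) \<noteq> {}"
    using bond_mem_bonds by blast
  ultimately have "PiM bonds (\<lambda>e. distr P conductance_space (\<lambda>a. a e)) =
      distr P (PiM bonds (\<lambda>_. conductance_space)) (\<lambda>a. \<lambda>e\<in>bonds. a e)"
    by (subst (asm) indep_vars_iff_distr_eq_PiM') (auto intro: conductance_measurable')
  also have "\<dots> = distr P P (\<lambda>a. a)"
    by (rule distr_cong) (auto simp: sets_env env_space_def space_env PiE_restrict)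
  finally show ?thesis by simp
qed

lemma translate_measurable: "translate x \<in> measurable P P"
proof -
  have "translate x \<in> measurable P env_space"
    unfolding translate_def[abs_def] env_space_def
    by (intro measurable_restrict conductance_measurable' image_plus_mem_bonds)
  then show ?thesis by (simp add: measurable_cong_sets[OF refl sets_env])
qed

text \<open>Translating an environment permutes the factors of the product measure, and it only
  exchanges bonds of the same orientation, whose factors agree.\<close>

lemma distr_translate: "distr P P (translate x) = P"
proof -
  define \<mu> where "\<mu> e = distr P conductance_space (\<lambda>a. a e)" for e
  have \<mu>_prob: "prob_space (\<mu> e)" if "e \<in> bonds" for e
    unfolding \<mu>_def by (rule prob_space_distr[OF conductance_measurable'[OF that]])
  have \<mu>_translate: "\<mu> ((+) x ` e) = \<mu> e" if e: "e \<in> bonds" for e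
  proof (rule measure_eqI)
    fix A assume "A \<in> sets (\<mu> ((+) x ` e))"
    then have A: "A \<in> sets conductance_space" by (simp add: \<mu>_def)
    obtain y i where y: "e = bond y i" by (rule bonds_cases[OF e])
    have "emeasure (\<mu> (bond z i)) A = emeasure (distr P borel (\<lambda>a. a (bond z i))) A" for z
      unfolding \<mu>_def
      using A sets_conductance_space[OF A]
      by (simp add: emeasure_distr conductance_measurable' conductance_measurable bond_mem_bonds)
    then show "emeasure (\<mu> ((+) x ` e)) A = emeasure (\<mu> e) A"
      unfolding y image_plus_bond using law_orientation[of "x + y" i y] by simp
  qed (simp add: \<mu>_def)
  \<comment> \<open>A total version of \<open>\<mu>\<close>: outside the bonds the coordinate need not be measurable.\<close>
  define \<nu> where "\<nu> e = (if e \<in> bonds then \<mu> e else \<mu> (bond 0 undefined))" for e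
  have P: "P = PiM bonds \<nu>"
    using env_eq_PiM unfolding \<mu>_def[symmetric] by (simp add: \<nu>_def cong: PiM_cong)
  have \<nu>: "prob_space (\<nu> e)" for e
    using \<mu>_prob bond_mem_bonds by (auto simp: \<nu>_def)
  have \<nu>_translate: "PiM bonds (\<lambda>e. \<nu> ((+) x ` e)) = PiM bonds \<nu>"
    by (rule PiM_cong) (auto simp: \<nu>_def \<mu>_translate image_plus_mem_bonds)
  have "distr P P (translate x) = distr (PiM bonds \<nu>) (PiM bonds (\<lambda>e. \<nu> ((+) x ` e)))
      (\<lambda>a. \<lambda>e\<in>bonds. a ((+) x ` e))"
    unfolding \<nu>_translate P[symmetric] translate_def[abs_def] ..
  also have "\<dots> = PiM bonds (\<lambda>e. \<nu> ((+) x ` e))"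
    by (rule distr_PiM_reindex)
       (use \<nu> in \<open>auto intro: inj_on_subset[OF inj_image_plus] image_plus_mem_bonds\<close>)
  also have "\<dots> = P" unfolding \<nu>_translate P[symmetric] ..
  finally show ?thesis .
qed

lemma integral_translate:
  fixes f :: "'d env \<Rightarrow> real"
  assumes "f \<in> borel_measurable P"
  shows "(\<integral>a. f (translate x a) \<partial>P) = (\<integral>a. f a \<partial>P)"
  using integral_distr[OF translate_measurable assms, of x] by (simp add: distr_translate)

lemma square_integrable_translate:
  assumes "square_integrable P f"
  shows "square_integrable P (\<lambda>a. f (translate x a))"
  unfolding square_integrable_def
proof
  show "(\<lambda>a. f (translate x a)) \<in> borel_measurable P"
    using measurable_compose[OF translate_measurable square_integrable_measurable[OF assms]] .
  show "integrable P (\<lambda>a. (f (translate x a))\<^sup>2)"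
    by (rule integrable_distr[OF translate_measurable, of x])
       (use assms in \<open>simp add: distr_translate square_integrable_def\<close>)
qed

lemma AE_translate:
  assumes "AE a in P. Q a"
  shows "AE a in P. Q (translate x a)"
  using AE_distrD[OF translate_measurable[of x], where P = Q] assms by (simp only: distr_translate)

lemma translate_translate_uminus:
  assumes "a \<in> space P"
  shows "translate x (translate (- x) a) = a"
proof
  fix e
  show "translate x (translate (- x) a) e = a e"
    using assms image_plus_mem_bonds[of e x]
    by (cases "e \<in> bonds") (auto simp: translate_def image_image space_env PiE_def extensional_def)
qed

lemma DaD_eq:
  assumes "a \<in> space P"
  shows "DaD v a = (\<Sum>i\<in>UNIV. a (bond 0 i) * (v a - v (translate (axis i 1) a))
      + a (bond (- axis i 1) i) * (v a - v (translate (- axis i 1) a)))"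
  unfolding DaD_def
proof (rule sum.cong[OF refl])
  fix i :: 'd
  have "translate (- axis i 1) a (bond 0 i) = a (bond (- axis i 1) i)"
    by (simp only: translate_def restrict_apply bond_mem_bonds if_True image_plus_bond add_0_right)
  then show "Dd_adj i (\<lambda>b. b (bond 0 i) * Dd i v b) a =
      a (bond 0 i) * (v a - v (translate (axis i 1) a))
      + a (bond (- axis i 1) i) * (v a - v (translate (- axis i 1) a))"
    by (simp add: Dd_adj_def Dd_def translate_translate_uminus[OF assms] algebra_simps)
qed

end

section \<open>Maximum principle and trapping\<close>

text \<open>One summand of the operator, tested against the positive part. The left-hand side is positive
  only if \<open>0 < p < q\<close>, and then \<open>q\<close> exceeds both \<open>p\<close> and \<open>q - p\<close>.\<close>

lemma positive_part_exchange:
  fixes c p q :: real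
  assumes "0 \<le> c" "c \<le> 1"
  shows "max 0 p * - (c * (p - q)) \<le> (max 0 q)\<^sup>2"
proof (cases "0 < p \<and> p < q")
  case True
  then have "c * (p * (q - p)) \<le> 1 * (q * q)"
    using assms by (intro mult_mono) auto
  then show ?thesis
    using True by (simp add: power2_eq_square algebra_simps)
next
  case False
  then have "max 0 p * (p - q) \<ge> 0"
    by (cases "0 < p") auto
  then have "c * (max 0 p * (p - q)) \<ge> 0"
    using assms by simp
  then have "max 0 p * - (c * (p - q)) \<le> 0"
    by (simp add: algebra_simps)
  also have "0 \<le> (max 0 q)\<^sup>2" by simp
  finally show ?thesis .
qed

context random_environment
begin

lemma square_integrable_const: "square_integrable P (\<lambda>_. c)"
  by (simp add: square_integrable_def)

lemma square_integrable_conductance_mult: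
  assumes "e \<in> bonds" "square_integrable P f"
  shows "square_integrable P (\<lambda>a. a e * f a)"
proof (rule square_integrable_bound[OF assms(2)])
  show "(\<lambda>a. a e * f a) \<in> borel_measurable P"
    using assms by (intro borel_measurable_times conductance_measurable) (auto simp: square_integrable_def)
  show "\<bar>a e * f a\<bar> \<le> \<bar>f a\<bar>" if "a \<in> space P" for a
    using conductance_bounds[OF that assms(1)] by (simp add: abs_mult mult_left_le_one_le)
qed

lemma square_integrable_DaD:
  assumes "square_integrable P v"
  shows "square_integrable P (DaD v)"
proof -
  have "square_integrable P (\<lambda>a. \<Sum>i\<in>UNIV. a (bond 0 i) * (v a - v (translate (axis i 1) a))
      + a (bond (- axis i 1) i) * (v a - v (translate (- axis i 1) a)))"
    by (intro square_integrable_sum square_integrable_add square_integrable_conductance_mult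
        square_integrable_diff square_integrable_translate assms bond_mem_bonds) simp
  then show ?thesis
    by (rule square_integrable_cong[THEN iffD1, rotated]) (simp add: DaD_eq)
qed

text \<open>Each summand of \<open>(u - K)\<^sub>+ DaD u\<close> is bounded below by minus the squared positive part at a
  neighbouring translate, whose integral does not depend on the translate by stationarity. This
  is the growth condition of the comparison lemma.\<close>

lemma solution_le:
  assumes sol: "parabolic_solution P g u" and g: "AE a in P. g a \<le> K" and t: "t \<ge> 0"
  shows "AE a in P. u t a \<le> K"
proof -
  have u: "square_integrable P (u s)" if "s \<ge> 0" for s
    using sol that by (simp add: parabolic_solution_def)
  have "AE a in P. u t a - K \<le> 0"
  proof (rule L2_comparison[where w = "\<lambda>t a. u t a - K" and z = "\<lambda>t a. - DaD (u t) a" and C = "2 * real CARD('d)"])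
    show "square_integrable P (\<lambda>a. u s a - K)" if "s \<ge> 0" for s
      by (intro square_integrable_diff square_integrable_const u that)
    show "square_integrable P (\<lambda>a. - DaD (u s) a)" if "s \<ge> 0" for s
      using square_integrable_cmult[OF square_integrable_DaD[OF u[OF that]], of "-1"] by simp
    show "((\<lambda>s. \<integral>\<^sup>+ a. ennreal (((u s a - K - (u r a - K)) / (s - r) - - DaD (u r) a)\<^sup>2) \<partial>P) \<longlongrightarrow> 0)
        (at r within {0..})" if "r \<ge> 0" for r
      using sol that by (simp add: parabolic_solution_def)
    show "AE a in P. u 0 a - K \<le> 0"
      using sol g unfolding parabolic_solution_def by (elim conjE AE_mp[rotated]) auto
    show "(\<integral>a. max 0 (u s a - K) * - DaD (u s) a \<partial>P)
        \<le> 2 * real CARD('d) * (\<integral>a. (max 0 (u s a - K))\<^sup>2 \<partial>P)" if s: "s \<ge> 0" for s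
    proof -
      define f where "f a = max 0 (u s a - K)" for a
      have f: "square_integrable P f"
        unfolding f_def
        by (rule square_integrable_bound[OF square_integrable_diff[OF u[OF s] square_integrable_const[of K]]])
           (use u[OF s] in \<open>auto simp: square_integrable_def\<close>)
      have f2: "integrable P (\<lambda>a. (f (translate x a))\<^sup>2)" for x
        using square_integrable_translate[OF f] by (simp add: square_integrable_def)
      have f_translate: "(\<integral>a. (f (translate x a))\<^sup>2 \<partial>P) = (\<integral>a. (f a)\<^sup>2 \<partial>P)" for x
        using integral_translate[of "\<lambda>a. (f a)\<^sup>2" x] f by (simp add: square_integrable_def)
      have "(\<integral>a. f a * - DaD (u s) a \<partial>P)
          \<le> (\<integral>a. (\<Sum>i\<in>UNIV. (f (translate (axis i 1) a))\<^sup>2 + (f (translate (- axis i 1) a))\<^sup>2) \<partial>P)"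
      proof (rule integral_mono)
        show "integrable P (\<lambda>a. f a * - DaD (u s) a)"
          using square_integrable_mult[OF f square_integrable_DaD[OF u[OF s]]] by simp
        show "integrable P (\<lambda>a. \<Sum>i\<in>UNIV. (f (translate (axis i 1) a))\<^sup>2 + (f (translate (- axis i 1) a))\<^sup>2)"
          using f2 by simp
        fix a assume a: "a \<in> space P"
        have *: "f a * - (a (bond x i) * (u s a - u s b)) \<le> (f b)\<^sup>2" for x i b
          using positive_part_exchange[OF conductance_bounds[OF a bond_mem_bonds[of x i]], of "u s a - K" "u s b - K"]
          by (simp add: f_def)
        have "f a * - DaD (u s) a =
            (\<Sum>i\<in>UNIV. f a * - (a (bond 0 i) * (u s a - u s (translate (axis i 1) a)))
              + f a * - (a (bond (- axis i 1) i) * (u s a - u s (translate (- axis i 1) a))))"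
          by (simp add: DaD_eq[OF a] sum_distrib_left distrib_left right_diff_distrib flip: sum_negf)
        also have "\<dots> \<le> (\<Sum>i\<in>UNIV. (f (translate (axis i 1) a))\<^sup>2 + (f (translate (- axis i 1) a))\<^sup>2)"
          by (intro sum_mono add_mono *)
        finally show "f a * - DaD (u s) a
            \<le> (\<Sum>i\<in>UNIV. (f (translate (axis i 1) a))\<^sup>2 + (f (translate (- axis i 1) a))\<^sup>2)" .
      qed
      also have "\<dots> = (\<Sum>i\<in>(UNIV :: 'd set). (\<integral>a. (f a)\<^sup>2 \<partial>P) + (\<integral>a. (f a)\<^sup>2 \<partial>P))"
        using f2 f_translate by simp
      finally show ?thesis by (simp add: f_def)
    qed
  qed (rule t)
  then show ?thesis by simp
qed

lemma parabolic_solution_uminus: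
  assumes "parabolic_solution P g u"
  shows "parabolic_solution P (\<lambda>a. - g a) (\<lambda>t a. - u t a)"
proof -
  have neg: "DaD (\<lambda>a. - v a) b = - DaD v b" for v :: "'d env \<Rightarrow> real" and b
    unfolding DaD_def sum_negf[symmetric] by (rule sum.cong) (auto simp: Dd_adj_def Dd_def algebra_simps)
  have "((- x - - y) / r + - z)\<^sup>2 = ((x - y) / r + z)\<^sup>2" for x y z r :: real
  proof -
    have "(- x - - y) / r + - z = - ((x - y) / r + z)" by (simp add: diff_divide_distrib)
    then show ?thesis by (simp only: power2_minus)
  qed
  with assms show ?thesis
    unfolding parabolic_solution_def neg square_integrable_def by simp
qed

lemma solution_abs_le:
  assumes sol: "parabolic_solution P g u" and g: "AE a in P. \<bar>g a\<bar> \<le> K" and t: "t \<ge> 0"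
  shows "AE a in P. \<bar>u t a\<bar> \<le> K"
proof -
  have "AE a in P. u t a \<le> K"
    by (rule solution_le[OF sol _ t]) (use g in \<open>auto elim: eventually_mono\<close>)
  moreover have "AE a in P. - u t a \<le> K"
    by (rule solution_le[OF parabolic_solution_uminus[OF sol] _ t]) (use g in \<open>auto elim: eventually_mono\<close>)
  ultimately show ?thesis by eventually_elim auto
qed

text \<open>Where all conductances at the origin are at most \<open>\<delta>\<close>, the random walk started there hardly
  moves: since \<open>\<bar>u\<bar> \<le> 1\<close>, each of the \<open>2 d\<close> neighbours changes \<open>u\<close> at rate at most
  \<open>2 \<delta>\<close>.\<close>

lemma solution_ge_initial:
  assumes sol: "parabolic_solution P g u" and g: "square_integrable P g"
    and bound: "AE a in P. \<bar>g a\<bar> \<le> 1" and t: "t \<ge> 0"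
    and A: "A \<in> sets P" and "\<delta> \<ge> 0"
    and slow: "\<And>a i. a \<in> A \<Longrightarrow> a (bond 0 i) \<le> \<delta>" "\<And>a i. a \<in> A \<Longrightarrow> a (bond (- axis i 1) i) \<le> \<delta>"
  shows "AE a in P. a \<in> A \<longrightarrow> u t a \<ge> g a - 4 * real CARD('d) * \<delta> * t"
proof -
  define \<kappa> where "\<kappa> = 4 * real CARD('d) * \<delta>"
  have u: "square_integrable P (u s)" if "s \<ge> 0" for s
    using sol that by (simp add: parabolic_solution_def)
  have restrict: "square_integrable P (\<lambda>a. indicator A a * f a)" if "square_integrable P f" for f
    by (rule square_integrable_bound[OF that])
       (use A that in \<open>auto simp: square_integrable_def indicator_def\<close>)
  have w: "square_integrable P (\<lambda>a. indicator A a * (g a - u s a - \<kappa> * s))" if "s \<ge> 0" for s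
    by (intro restrict square_integrable_diff g u that square_integrable_const)
  have z: "square_integrable P (\<lambda>a. indicator A a * (DaD (u s) a - \<kappa>))" if "s \<ge> 0" for s
    by (intro restrict square_integrable_diff square_integrable_DaD u that square_integrable_const)
  have "AE a in P. indicator A a * (g a - u t a - \<kappa> * t) \<le> 0"
  proof (rule L2_comparison[where z = "\<lambda>s a. indicator A a * (DaD (u s) a - \<kappa>)" and C = 0, OF w z])
    fix r :: real assume r: "r \<ge> 0"
    show "((\<lambda>s. \<integral>\<^sup>+ a. ennreal (((indicator A a * (g a - u s a - \<kappa> * s) - indicator A a * (g a - u r a - \<kappa> * r)) / (s - r)
        - indicator A a * (DaD (u r) a - \<kappa>))\<^sup>2) \<partial>P) \<longlongrightarrow> 0) (at r within {0..})"
    proof (rule tendsto_sandwich[where f = "\<lambda>_. 0"])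
      show "((\<lambda>s. \<integral>\<^sup>+ a. ennreal (((u s a - u r a) / (s - r) + DaD (u r) a)\<^sup>2) \<partial>P) \<longlongrightarrow> 0) (at r within {0..})"
        using sol r by (simp add: parabolic_solution_def)
      have "\<forall>\<^sub>F s in at r within {0..}. s \<noteq> r"
        by (simp add: eventually_at_filter)
      then show "\<forall>\<^sub>F s in at r within {0..}.
          (\<integral>\<^sup>+ a. ennreal (((indicator A a * (g a - u s a - \<kappa> * s) - indicator A a * (g a - u r a - \<kappa> * r)) / (s - r)
            - indicator A a * (DaD (u r) a - \<kappa>))\<^sup>2) \<partial>P)
          \<le> (\<integral>\<^sup>+ a. ennreal (((u s a - u r a) / (s - r) + DaD (u r) a)\<^sup>2) \<partial>P)"
      proof eventually_elim
        case (elim s)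
        have "((g a - u s a - \<kappa> * s) - (g a - u r a - \<kappa> * r)) / (s - r) - (DaD (u r) a - \<kappa>)
            = - ((u s a - u r a) / (s - r) + DaD (u r) a)" for a
          using elim by (simp add: field_simps)
        then have "(((g a - u s a - \<kappa> * s) - (g a - u r a - \<kappa> * r)) / (s - r) - (DaD (u r) a - \<kappa>))\<^sup>2
            = ((u s a - u r a) / (s - r) + DaD (u r) a)\<^sup>2" for a
          by (simp only: power2_minus)
        then show ?case
          by (intro nn_integral_mono ennreal_leI) (simp add: indicator_def)
      qed
    qed simp_all
    have b: "AE a in P. \<bar>u r a\<bar> \<le> 1"
      by (rule solution_abs_le[OF sol bound r])
    have bt: "AE a in P. \<forall>i. \<bar>u r (translate (axis i 1) a)\<bar> \<le> 1 \<and> \<bar>u r (translate (- axis i 1) a)\<bar> \<le> 1"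
      using AE_translate[OF b] by (subst AE_all_countable) auto
    have "AE a in P. max 0 (indicator A a * (g a - u r a - \<kappa> * r)) * (indicator A a * (DaD (u r) a - \<kappa>)) \<le> 0"
      using b bt AE_space
    proof eventually_elim
      case (elim a)
      show ?case
      proof (cases "a \<in> A")
        case True
        have *: "a (bond x i) * (u r a - q) \<le> \<delta> * 2" if "a (bond x i) \<le> \<delta>" "\<bar>q\<bar> \<le> 1" for x i q
        proof -
          have "a (bond x i) * (u r a - q) \<le> a (bond x i) * 2"
            using elim(1) that(2) conductance_bounds[OF elim(3) bond_mem_bonds[of x i]]
            by (intro mult_left_mono) auto
          also have "\<dots> \<le> \<delta> * 2" using that(1) by simp
          finally show ?thesis .
        qed
        have "DaD (u r) a \<le> (\<Sum>i\<in>(UNIV :: 'd set). \<delta> * 2 + \<delta> * 2)"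
          unfolding DaD_eq[OF elim(3)]
          by (intro sum_mono add_mono *) (use elim slow[OF True] in auto)
        then have "DaD (u r) a \<le> \<kappa>" by (simp add: \<kappa>_def)
        then show ?thesis by (simp add: mult_nonneg_nonpos)
      qed simp
    qed
    then have "0 \<le> (\<integral>a. - (max 0 (indicator A a * (g a - u r a - \<kappa> * r)) * (indicator A a * (DaD (u r) a - \<kappa>))) \<partial>P)"
      by (intro integral_nonneg_AE) (auto elim: eventually_mono)
    then show "(\<integral>a. max 0 (indicator A a * (g a - u r a - \<kappa> * r)) * (indicator A a * (DaD (u r) a - \<kappa>)) \<partial>P)
        \<le> 0 * (\<integral>a. (max 0 (indicator A a * (g a - u r a - \<kappa> * r)))\<^sup>2 \<partial>P)"
      by simp
  next
    show "AE a in P. indicator A a * (g a - u 0 a - \<kappa> * 0) \<le> 0"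
      using sol unfolding parabolic_solution_def by (elim conjE AE_mp) auto
  qed (use t in auto)
  then show ?thesis
    by eventually_elim (auto simp: \<kappa>_def)
qed

end

section \<open>Traps and their probability\<close>

text \<open>If \<open>X\<close> put mass at most \<open>2 powr (- (q + 1) n)\<close> on \<open>X \<le> 2 powr - n\<close> for all large \<open>n\<close>, then
  summing \<open>X powr - q\<close> over dyadic scales would give a convergent geometric series.\<close>

lemma (in prob_space) small_ball_of_infinite_negative_moment:
  fixes X :: "'a \<Rightarrow> real"
  assumes X: "X \<in> borel_measurable M"
    and X_bounds: "\<And>a. a \<in> space M \<Longrightarrow> 0 \<le> X a" "\<And>a. a \<in> space M \<Longrightarrow> X a \<le> 1"
    and q: "q > 0"
    and moment: "(\<integral>\<^sup>+a. ennreal_powr (ennreal (X a)) (- q) \<partial>M) = \<infinity>"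
  shows "\<exists>n\<ge>N. prob {a \<in> space M. X a \<le> 2 powr - real n} > 2 powr (- (q + 1) * real n)"
proof (rule ccontr)
  assume "\<not> ?thesis"
  then have small: "prob {a \<in> space M. X a \<le> 2 powr - real n} \<le> 2 powr (- (q + 1) * real n)" if "n \<ge> N" for n
    using that by (auto simp: not_less)
  define S where "S n = {a \<in> space M. X a \<le> 2 powr - real n}" for n :: nat
  have S [measurable]: "S n \<in> sets M" for n
    unfolding S_def using X by measurable
  \<comment> \<open>At a zero of \<open>X\<close> every term of the series is at least one, so both sides are infinite.\<close>
  have pointwise: "ennreal_powr (ennreal (X a)) (- q) \<le>
      ennreal (2 powr (q * real N)) + (\<Sum>n. ennreal (2 powr (q * real (n + N + 1))) * indicator (S (n + N)) a)"
    if a: "a \<in> space M" for a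
  proof (cases "X a = 0")
    case True
    have "(\<Sum>n. ennreal (2 powr (q * real (n + N + 1))) * indicator (S (n + N)) a) = \<infinity>"
    proof -
      have "of_nat m \<le> (\<Sum>n. ennreal (2 powr (q * real (n + N + 1))) * indicator (S (n + N)) a)" for m
      proof -
        have "(of_nat m :: ennreal) = (\<Sum>n<m. 1)" by simp
        also have "\<dots> \<le> (\<Sum>n<m. ennreal (2 powr (q * real (n + N + 1))) * indicator (S (n + N)) a)"
        proof (rule sum_mono)
          fix n
          have "1 \<le> (2::real) powr (q * real (n + N + 1))"
            using q by (intro ge_one_powr_ge_zero) auto
          then show "1 \<le> ennreal (2 powr (q * real (n + N + 1))) * indicator (S (n + N)) a"
            using True a by (simp add: S_def)
        qed
        also have "\<dots> \<le> (\<Sum>n. ennreal (2 powr (q * real (n + N + 1))) * indicator (S (n + N)) a)"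
          by (rule sum_le_suminf) auto
        finally show ?thesis .
      qed
      then have "(SUP m. of_nat m) \<le> (\<Sum>n. ennreal (2 powr (q * real (n + N + 1))) * indicator (S (n + N)) a)"
        by (rule SUP_least)
      then show ?thesis
        by (simp add: ennreal_SUP_of_nat_eq_top top_unique)
    qed
    then show ?thesis by simp
  next
    case False
    then have pos: "X a > 0" using X_bounds(1)[OF a] by simp
    have val: "ennreal_powr (ennreal (X a)) (- q) = ennreal (X a powr - q)"
      using pos q by (simp add: ennreal_powr_def)
    show ?thesis
    proof (cases "X a \<le> 2 powr - real N")
      case True
      define m where "m = nat \<lfloor>- log 2 (X a)\<rfloor>"
      have log: "real N \<le> - log 2 (X a)"
        using True pos log_le_iff[of 2 "X a" "- real N"] by simp
      then have m: "real m \<le> - log 2 (X a)" "- log 2 (X a) < real m + 1" "N \<le> m"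
        unfolding m_def by (linarith, linarith, simp add: le_nat_floor le_nat_iff le_floor_iff)
      have "X a \<le> 2 powr - real m"
        using m(1) pos log_le_iff[of 2 "X a" "- real m"] by simp
      then have in_S: "a \<in> S (m - N + N)"
        using a m(3) by (simp add: S_def)
      have "X a powr - q = 2 powr (- q * log 2 (X a))"
        using pos by (simp add: powr_def log_def)
      also have "\<dots> \<le> 2 powr (q * real (m - N + N + 1))"
      proof (intro powr_mono)
        have "q * - log 2 (X a) \<le> q * real (m - N + N + 1)"
          using m q by (intro mult_left_mono) auto
        then show "- q * log 2 (X a) \<le> q * real (m - N + N + 1)" by simp
      qed simp
      finally have "ennreal (X a powr - q) \<le> ennreal (2 powr (q * real (m - N + N + 1))) * indicator (S (m - N + N)) a"
        using in_S by (simp add: ennreal_leI)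
      also have "\<dots> \<le> (\<Sum>n. ennreal (2 powr (q * real (n + N + 1))) * indicator (S (n + N)) a)"
      proof -
        have "f k \<le> suminf f" for f :: "nat \<Rightarrow> ennreal" and k
          using sum_le_suminf[of f "{k}"] by simp
        then show ?thesis .
      qed
      finally show ?thesis unfolding val by (simp add: add_increasing)
    next
      case False
      then have "X a powr - q \<le> (2 powr - real N) powr - q"
        using q by (intro powr_mono2') auto
      also have "\<dots> = 2 powr (q * real N)" by (simp add: powr_powr mult.commute)
      finally show ?thesis unfolding val by (intro add_increasing2) (auto intro: ennreal_leI)
    qed
  qed
  have "(\<integral>\<^sup>+a. ennreal_powr (ennreal (X a)) (- q) \<partial>M)
      \<le> (\<integral>\<^sup>+a. ennreal (2 powr (q * real N)) + (\<Sum>n. ennreal (2 powr (q * real (n + N + 1))) * indicator (S (n + N)) a) \<partial>M)"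
    by (rule nn_integral_mono) (rule pointwise)
  also have "\<dots> = ennreal (2 powr (q * real N)) + (\<Sum>n. ennreal (2 powr (q * real (n + N + 1))) * emeasure M (S (n + N)))"
    by (simp add: nn_integral_add nn_integral_suminf nn_integral_cmult_indicator emeasure_space_1)
  also have "\<dots> \<le> ennreal (2 powr (q * real N)) + (\<Sum>n. ennreal (2 powr q * (1 / 2) ^ n))"
  proof (intro add_left_mono suminf_le summableI)
    fix n
    have "2 powr (q * real (n + N + 1)) * prob (S (n + N)) \<le> 2 powr (q * real (n + N + 1)) * 2 powr (- (q + 1) * real (n + N))"
      using small[of "n + N"] by (intro mult_left_mono) (auto simp: S_def)
    also have "\<dots> = 2 powr q * 2 powr - real (n + N)"
      by (simp add: powr_add[symmetric] algebra_simps)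
    also have "\<dots> \<le> 2 powr q * 2 powr - real n"
      by (intro mult_left_mono powr_mono) auto
    also have "\<dots> = 2 powr q * (1 / 2) ^ n"
      by (simp add: powr_minus powr_realpow power_one_over inverse_eq_divide)
    finally show "ennreal (2 powr (q * real (n + N + 1))) * emeasure M (S (n + N)) \<le> ennreal (2 powr q * (1 / 2) ^ n)"
      by (simp add: emeasure_eq_measure ennreal_mult[symmetric] ennreal_leI)
  qed
  also have "\<dots> < \<infinity>"
    by (subst suminf_ennreal2) (auto intro!: summable_mult summable_geometric)
  finally show False using moment by simp
qed

lemma axis_one_neq_uminus_axis: "axis i (1::int) \<noteq> - axis j 1"
proof
  assume "axis i (1::int) = - axis j 1"
  then have "axis i (1::int) $ i = (- axis j 1) $ i" by simp
  then show False by (simp add: axis_def split: if_splits)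
qed

lemma inj_bond_origin: "inj (\<lambda>i. bond (0 :: int ^ 'd::finite) i)"
proof (rule injI)
  fix i j :: 'd
  assume "bond 0 i = bond 0 j"
  then have "axis i (1::int) = axis j 1"
    by (auto simp: bond_def doubleton_eq_iff axis_eq_0_iff)
  then show "i = j" by (simp add: axis_eq_axis)
qed

lemma inj_bond_into_origin: "inj (\<lambda>i. bond (- axis i 1 :: int ^ 'd::finite) i)"
proof (rule injI)
  fix i j :: 'd
  assume "bond (- axis i 1) i = bond (- axis j 1 :: int ^ 'd) j"
  then have "axis i (1::int) = axis j 1"
    by (auto simp: bond_def doubleton_eq_iff axis_eq_0_iff)
  then show "i = j" by (simp add: axis_eq_axis)
qed

lemma bond_origin_neq: "bond (0 :: int ^ 'd::finite) i \<noteq> bond (- axis j 1) j"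
  using axis_one_neq_uminus_axis[of i j] by (auto simp: bond_def doubleton_eq_iff)

context random_environment
begin

text \<open>The \<open>2 d\<close> bonds at the origin and \<open>e\<close> are distinct, hence independent. The bonds that end at
  the origin have the same laws as those that start there, so each half of the star contributes
  the same factor.\<close>

lemma prob_star_inter:
  assumes e: "e \<in> bonds" "0 \<notin> e" and B: "B \<in> sets borel"
  shows "prob {a \<in> space P. (\<forall>i. a (bond 0 i) \<le> \<delta> \<and> a (bond (- axis i 1) i) \<le> \<delta>) \<and> a e \<in> B}
    = (prob {a \<in> space P. (SUP i. a (bond 0 i)) \<le> \<delta>})\<^sup>2 * prob {a \<in> space P. a e \<in> B}"
proof -
  define J where "J = range (bond (0 :: int ^ 'd))"
  define J' where "J' = range (\<lambda>i. bond (- axis i 1 :: int ^ 'd) i)"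
  have fin: "finite J" "finite J'" by (simp_all add: J_def J'_def)
  have disj: "J \<inter> J' = {}" "e \<notin> J \<union> J'"
    using e(2) bond_origin_neq by (auto simp: J_def J'_def bond_def)
  have sub: "J \<subseteq> bonds" "J' \<subseteq> bonds" by (auto simp: J_def J'_def bond_mem_bonds)
  define F where "F f = (if f = e then B else {..\<delta>})" for f
  define E where "E f = (\<lambda>a. a f) -` F f \<inter> space P" for f
  have ind: "prob (\<Inter>f\<in>K. E f) = (\<Prod>f\<in>K. prob (E f))" if "K \<subseteq> bonds" "finite K" "K \<noteq> {}" for K
    unfolding E_def by (rule indep_varsD[OF indep_conductances]) (use that B in \<open>auto simp: F_def\<close>)
  have J_nonempty: "J \<noteq> {}" by (simp add: J_def)
  have E_le: "E f = {a \<in> space P. a f \<le> \<delta>}" if "f \<in> J \<union> J'" for f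
    using that disj by (auto simp: E_def F_def)
  have E_e: "E e = {a \<in> space P. a e \<in> B}"
    by (auto simp: E_def F_def)
  have "(\<Prod>f\<in>J'. prob (E f)) = (\<Prod>i\<in>UNIV. prob (E (bond (- axis i 1) i)))"
    unfolding J'_def by (simp add: prod.reindex[OF inj_bond_into_origin])
  also have "\<dots> = (\<Prod>i\<in>UNIV. prob (E (bond 0 i)))"
  proof (rule prod.cong[OF refl])
    fix i :: 'd
    have "bond (- axis i 1) i \<in> J \<union> J'" "bond 0 i \<in> J \<union> J'" by (auto simp: J_def J'_def)
    then show "prob (E (bond (- axis i 1) i)) = prob (E (bond 0 i))"
      using prob_conductance_eq[of "{..\<delta>}" "- axis i 1" i 0] by (simp add: E_le)
  qed
  also have "\<dots> = (\<Prod>f\<in>J. prob (E f))"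
    unfolding J_def by (simp add: prod.reindex[OF inj_bond_origin])
  finally have J'_eq: "(\<Prod>f\<in>J'. prob (E f)) = (\<Prod>f\<in>J. prob (E f))" .
  have "(\<Inter>f\<in>J. E f) = {a \<in> space P. (SUP i. a (bond 0 i)) \<le> \<delta>}"
  proof -
    have "(SUP i. a (bond 0 i)) \<le> \<delta> \<longleftrightarrow> (\<forall>i. a (bond 0 i) \<le> \<delta>)" for a :: "'d env"
      by (subst cSUP_le_iff) auto
    then show ?thesis using J_nonempty E_le by (auto simp: J_def)
  qed
  then have J_eq: "(\<Prod>f\<in>J. prob (E f)) = prob {a \<in> space P. (SUP i. a (bond 0 i)) \<le> \<delta>}"
    using ind[OF sub(1) fin(1) J_nonempty] by simp
  have "{a \<in> space P. (\<forall>i. a (bond 0 i) \<le> \<delta> \<and> a (bond (- axis i 1) i) \<le> \<delta>) \<and> a e \<in> B}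
      = (\<Inter>f\<in>insert e (J \<union> J'). E f)"
    using E_le E_e by (auto simp: J_def J'_def)
  also have "prob \<dots> = (\<Prod>f\<in>insert e (J \<union> J'). prob (E f))"
    using e(1) sub fin by (intro ind) auto
  also have "\<dots> = prob (E e) * ((\<Prod>f\<in>J. prob (E f)) * (\<Prod>f\<in>J'. prob (E f)))"
    using fin disj by (simp add: prod.union_disjoint)
  finally show ?thesis by (simp add: J'_eq J_eq E_e power2_eq_square mult.commute)
qed

text \<open>A conductance that never exceeds its mean is almost surely constant. The constant is not
  zero, as no conductance vanishes almost surely; the bond at the origin with the same orientation
  would then have this positive value, and all negative moments would be finite.\<close>

lemma conductance_exceeds_mean:
  assumes e: "e \<in> bonds" and q: "q > 0"
    and moment: "(\<integral>\<^sup>+ a. ennreal_powr (ennreal (SUP i. a (bond 0 i))) (- q) \<partial>P) = \<infinity>"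
  obtains \<epsilon> where "\<epsilon> > 0" "prob {a \<in> space P. a e - (\<integral>b. b e \<partial>P) \<ge> 2 * \<epsilon>} > 0"
proof -
  define c where "c = (\<integral>b. b e \<partial>P)"
  have meas: "(\<lambda>a. a e) \<in> borel_measurable P" and int: "integrable P (\<lambda>a. a e)"
    using e by (rule conductance_measurable, rule conductance_integrable)
  have "\<exists>\<epsilon>>0. prob {a \<in> space P. a e - c \<ge> 2 * \<epsilon>} \<noteq> 0"
  proof (rule ccontr)
    assume "\<not> ?thesis"
    then have null: "prob {a \<in> space P. a e - c \<ge> 2 * \<epsilon>} = 0" if "\<epsilon> > 0" for \<epsilon> using that by blast
    have "AE a in P. a e - c < 2 / real (Suc n)" for n
    proof -
      have "{a \<in> space P. a e - c \<ge> 2 * (1 / real (Suc n))} \<in> sets P"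
        using meas by measurable
      then have "AE a in P. a \<notin> {a \<in> space P. a e - c \<ge> 2 * (1 / real (Suc n))}"
        using null[of "1 / real (Suc n)"] prob_eq_0 by simp
      then show ?thesis using AE_space by eventually_elim auto
    qed
    then have "AE a in P. \<forall>n. a e - c < 2 / real (Suc n)"
      by (subst AE_all_countable) simp
    then have le: "AE a in P. 0 \<le> c - a e"
    proof eventually_elim
      case (elim a)
      show ?case
      proof (rule ccontr)
        assume "\<not> 0 \<le> c - a e"
        then have "0 < (a e - c) / 2" by simp
        from reals_Archimedean[OF this] obtain n where "inverse (real (Suc n)) < (a e - c) / 2" ..
        then have "2 * inverse (real (Suc n)) < 2 * ((a e - c) / 2)"
          by (rule mult_strict_left_mono) simp
        also have "\<dots> = a e - c" by (rule field_sum_of_halves[folded mult_2])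
        also from elim have "a e - c < 2 / real (Suc n)" ..
        finally show False unfolding divide_inverse by (simp only: less_irrefl)
      qed
    qed
    have "(\<integral>a. c - a e \<partial>P) = 0"
      using int by (simp add: c_def prob_space)
    then have "AE a in P. c - a e = 0"
      using int by (subst (asm) integral_nonneg_eq_0_iff_AE[OF _ le]) auto
    then have const: "AE a in P. a e = c" by eventually_elim simp
    have "c \<ge> 0"
      unfolding c_def by (rule Bochner_Integration.integral_nonneg) (use conductance_bounds e in auto)
    moreover have "c \<noteq> 0"
    proof
      assume "c = 0"
      then have "prob {a \<in> space P. a e = 0} = 1"
        using const meas by (subst prob_Collect_eq_1) auto
      then show False using not_ae_zero[OF e] by simp
    qed
    ultimately have "c > 0" by simp
    obtain x i where xi: "e = bond x i" by (rule bonds_cases[OF e])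
    have "prob {a \<in> space P. a (bond 0 i) = c} = prob {a \<in> space P. a e = c}"
      using prob_conductance_eq[of "{c}" 0 i x] by (simp add: xi)
    also have "\<dots> = 1"
      using const meas by (subst prob_Collect_eq_1) auto
    finally have "prob {a \<in> space P. a (bond 0 i) = c} = 1" .
    then have "AE a in P. a (bond 0 i) = c"
      using conductance_measurable[OF bond_mem_bonds, of 0 i] by (subst (asm) prob_Collect_eq_1) auto
    then have "AE a in P. ennreal_powr (ennreal (SUP i. a (bond 0 i))) (- q) \<le> ennreal (c powr - q)"
    proof eventually_elim
      case (elim a)
      have "c \<le> (SUP i. a (bond 0 i))"
        unfolding elim[symmetric] by (rule cSUP_upper) auto
      moreover from this have "(SUP i. a (bond 0 i)) powr - q \<le> c powr - q"
        using \<open>c > 0\<close> q by (intro powr_mono2') auto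
      ultimately show ?case
        using \<open>c > 0\<close> q by (auto simp: ennreal_powr_def intro: ennreal_leI)
    qed
    then have "(\<integral>\<^sup>+ a. ennreal_powr (ennreal (SUP i. a (bond 0 i))) (- q) \<partial>P) \<le> (\<integral>\<^sup>+ a. ennreal (c powr - q) \<partial>P)"
      by (rule nn_integral_mono_AE)
    then show False using moment by (simp add: emeasure_space_1 top_unique)
  qed
  then obtain \<epsilon> where "\<epsilon> > 0" "prob {a \<in> space P. a e - c \<ge> 2 * \<epsilon>} \<noteq> 0"
    by blast
  then show thesis
    by (intro that[of \<epsilon>]) (simp_all only: zero_less_measure_iff c_def not_False_eq_True)
qed

end

section \<open>Failure of the decay\<close>

lemma ennreal_powr_lower_bound:
  assumes "0 < y" "0 < r" "ennreal y \<le> x"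
  shows "ennreal (y powr r) \<le> ennreal_powr x r"
proof (cases x)
  case (real z)
  then have "y \<le> z" using assms by simp
  then show ?thesis
    using assms real by (auto simp: ennreal_powr_def intro!: ennreal_leI powr_mono2)
qed (use assms in \<open>simp add: ennreal_powr_def\<close>)

theorem mainTheorem3:
  fixes P :: "'d::finite env measure"
    and e :: "(int ^ 'd) set"
    and u :: "real \<Rightarrow> 'd env \<Rightarrow> real"
  assumes "CARD('d) > 2"
    and "random_environment P"
    and "\<not> (\<forall>q::real. q \<ge> 1 \<longrightarrow>
            (\<integral>\<^sup>+ a. ennreal_powr (ennreal (SUP i. a (bond 0 i))) (- q) \<partial>P) < \<infinity>)"
    and "e \<in> bonds"
    and "0 \<notin> e"
    and "parabolic_solution P (\<lambda>a. a e - (\<integral>b. b e \<partial>P)) u"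
  shows "\<not> (\<forall>p::real. p \<ge> 1 \<longrightarrow>
            (SUP t\<in>{1..}. ennreal (t powr (real CARD('d) / 2)) *
               ennreal_powr (\<integral>\<^sup>+ a. ennreal (\<bar>u t a\<bar> powr (2 * p)) \<partial>P) (1 / p)) < \<infinity>)"
proof
  assume decay: "\<forall>p::real. p \<ge> 1 \<longrightarrow>
            (SUP t\<in>{1..}. ennreal (t powr (real CARD('d) / 2)) *
               ennreal_powr (\<integral>\<^sup>+ a. ennreal (\<bar>u t a\<bar> powr (2 * p)) \<partial>P) (1 / p)) < \<infinity>"
  interpret random_environment P by fact
  define d where "d = real CARD('d)"
  have d: "d \<ge> 3" using assms(1) by (simp add: d_def)
  obtain q :: real where q: "q \<ge> 1"
    and moment: "(\<integral>\<^sup>+ a. ennreal_powr (ennreal (SUP i. a (bond 0 i))) (- q) \<partial>P) = \<infinity>"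
    using assms(3) by (auto simp: less_top[symmetric])
  define g where "g a = a e - (\<integral>b. b e \<partial>P)" for a
  have sol: "parabolic_solution P g u" using assms(6) by (simp add: g_def[abs_def])
  obtain \<epsilon> where \<epsilon>: "\<epsilon> > 0" and \<pi>_pos: "prob {a \<in> space P. g a \<ge> 2 * \<epsilon>} > 0"
    using conductance_exceeds_mean[OF assms(4) _ moment] q unfolding g_def by auto
  define \<pi> where "\<pi> = prob {a \<in> space P. g a \<ge> 2 * \<epsilon>}"
  have \<pi>: "\<pi> > 0" using \<pi>_pos by (simp add: \<pi>_def)

  have mean: "0 \<le> (\<integral>b. b e \<partial>P)" "(\<integral>b. b e \<partial>P) \<le> 1"
  proof -
    show "0 \<le> (\<integral>b. b e \<partial>P)"
      by (rule Bochner_Integration.integral_nonneg) (use conductance_bounds assms(4) in auto)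
    show "(\<integral>b. b e \<partial>P) \<le> 1"
      by (rule integral_le_const[OF conductance_integrable[OF assms(4)]])
         (use conductance_bounds assms(4) in \<open>auto intro: AE_I2\<close>)
  qed
  have g_bound: "\<bar>g a\<bar> \<le> 1" if "a \<in> space P" for a
    using conductance_bounds[OF that assms(4)] mean by (auto simp: g_def)
  have g_meas: "g \<in> borel_measurable P"
    unfolding g_def[abs_def] by (intro borel_measurable_diff conductance_measurable assms(4)) simp
  have g_sq: "square_integrable P g"
    by (rule square_integrable_bound[OF square_integrable_const[of 1] g_meas]) (use g_bound in auto)

  define X where "X a = (SUP i. a (bond 0 i))" for a :: "'d env"
  have X_meas: "X \<in> borel_measurable P"
    unfolding X_def by (intro borel_measurable_cSUP conductance_measurable bond_mem_bonds) auto
  have X_nonneg: "0 \<le> X a" if "a \<in> space P" for a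
    unfolding X_def by (rule cSUP_upper2[where x = undefined]) (use conductance_bounds[OF that bond_mem_bonds] in auto)
  have X_le: "X a \<le> 1" if "a \<in> space P" for a
    unfolding X_def by (rule cSUP_least) (use conductance_bounds[OF that bond_mem_bonds] in auto)

  \<comment> \<open>With this exponent the \<open>p\<close>-th root of the probability of the trap, about
      \<open>2 powr (- 2 (q + 1) n)\<close>, is \<open>2 powr (- n / 2)\<close>.\<close>
  define p where "p = 4 * (q + 1)"
  have p: "p \<ge> 1" using q by (simp add: p_def)
  define C where "C = enn2real (SUP t\<in>{1..}. ennreal (t powr (d / 2)) *
      ennreal_powr (\<integral>\<^sup>+ a. ennreal (\<bar>u t a\<bar> powr (2 * p)) \<partial>P) (1 / p))"
  have C: "ennreal (t powr (d / 2)) * ennreal_powr (\<integral>\<^sup>+ a. ennreal (\<bar>u t a\<bar> powr (2 * p)) \<partial>P) (1 / p) \<le> ennreal C"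
    if "t \<ge> 1" for t
  proof -
    have "(SUP t\<in>{1..}. ennreal (t powr (d / 2)) *
      ennreal_powr (\<integral>\<^sup>+ a. ennreal (\<bar>u t a\<bar> powr (2 * p)) \<partial>P) (1 / p)) = ennreal C"
      unfolding C_def d_def using decay p by (subst ennreal_enn2real) auto
    then show ?thesis using that by (metis (mono_tags, lifting) SUP_upper atLeast_iff)
  qed

  \<comment> \<open>The part of the final lower bound that does not depend on the depth \<open>n\<close> of the trap.\<close>
  define K where "K = (\<epsilon> / (4 * d)) powr (d / 2) * (\<epsilon> powr 2 * \<pi> powr (1 / p))"
  have K: "K > 0" using \<epsilon> \<pi> d by (simp add: K_def)
  obtain N where N: "max (C / K) (4 * d / \<epsilon>) < 2 ^ N"
    using real_arch_pow[of 2 "max (C / K) (4 * d / \<epsilon>)"] by (meson one_less_numeral_iff semiring_norm(76))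
  obtain n where n: "n \<ge> N" "prob {a \<in> space P. X a \<le> 2 powr - real n} > 2 powr (- (q + 1) * real n)"
    using small_ball_of_infinite_negative_moment[OF X_meas X_nonneg X_le _ moment[folded X_def]] q by force
  have "(2::real) ^ N \<le> 2 ^ n" using n(1) by simp
  with N have "max (C / K) (4 * d / \<epsilon>) < 2 ^ n" by (rule less_le_trans)
  then have n_large: "C / K < 2 powr real n" "4 * d / \<epsilon> < 2 powr real n"
    by (simp_all add: powr_realpow)

  define \<delta> where "\<delta> = 2 powr - real n"
  \<comment> \<open>The longest time over which the trap keeps \<open>u\<close> within \<open>\<epsilon>\<close> of its initial value.\<close>
  define t where "t = \<epsilon> / (4 * d) * 2 powr real n"
  have t: "t \<ge> 1" using n_large(2) \<epsilon> d by (simp add: t_def field_simps)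
  have \<delta>t: "4 * d * \<delta> * t = \<epsilon>"
    using d by (simp add: \<delta>_def t_def powr_minus field_simps)
  define A where "A = {a \<in> space P. \<forall>i. a (bond 0 i) \<le> \<delta> \<and> a (bond (- axis i 1) i) \<le> \<delta>}"
  define G where "G = {a \<in> space P. (\<forall>i. a (bond 0 i) \<le> \<delta> \<and> a (bond (- axis i 1) i) \<le> \<delta>)
      \<and> a e \<in> {2 * \<epsilon> + (\<integral>b. b e \<partial>P)..}}"
  have [measurable]: "(\<lambda>a. a f) \<in> borel_measurable P" if "f \<in> bonds" for f
    by (rule conductance_measurable[OF that])
  have A_sets: "A \<in> sets P"
    unfolding A_def using bond_mem_bonds assms(4) by measurable
  have G_sets: "G \<in> sets P"
    unfolding G_def using bond_mem_bonds assms(4) by measurable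

  have "AE a in P. a \<in> A \<longrightarrow> u t a \<ge> g a - 4 * real CARD('d) * \<delta> * t"
    by (rule solution_ge_initial[OF sol g_sq _ _ A_sets])
       (use g_bound t in \<open>auto simp: A_def \<delta>_def intro: AE_I2\<close>)
  then have u_ge: "AE a in P. a \<in> G \<longrightarrow> u t a \<ge> \<epsilon>"
    unfolding d_def[symmetric] \<delta>t by eventually_elim (auto simp: G_def A_def g_def)

  have "{a \<in> space P. a e \<in> {2 * \<epsilon> + (\<integral>b. b e \<partial>P)..}} = {a \<in> space P. g a \<ge> 2 * \<epsilon>}"
    by (auto simp: g_def)
  then have "prob G = (prob {a \<in> space P. X a \<le> \<delta>})\<^sup>2 * \<pi>"
    unfolding G_def X_def \<pi>_def by (subst prob_star_inter[OF assms(4,5)]) auto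
  moreover have "(2 powr (- (q + 1) * real n))\<^sup>2 \<le> (prob {a \<in> space P. X a \<le> \<delta>})\<^sup>2"
    using n(2) by (intro power_mono) (auto simp: \<delta>_def)
  ultimately have prob_G: "2 powr (- 2 * (q + 1) * real n) * \<pi> \<le> prob G"
    using \<pi> by (simp add: power2_eq_square powr_add[symmetric] algebra_simps)

  define y where "y = \<epsilon> powr (2 * p) * (2 powr (- 2 * (q + 1) * real n) * \<pi>)"
  have y: "y > 0" using \<epsilon> \<pi> by (simp add: y_def)
  have "ennreal y \<le> ennreal (\<epsilon> powr (2 * p) * prob G)"
    unfolding y_def using prob_G by (intro ennreal_leI mult_left_mono) auto
  also have "\<dots> = (\<integral>\<^sup>+ a. ennreal (\<epsilon> powr (2 * p)) * indicator G a \<partial>P)"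
    using G_sets by (simp add: nn_integral_cmult_indicator emeasure_eq_measure ennreal_mult)
  also have "\<dots> \<le> (\<integral>\<^sup>+ a. ennreal (\<bar>u t a\<bar> powr (2 * p)) \<partial>P)"
    using u_ge
  proof (rule nn_integral_mono_AE[OF eventually_mono])
    fix a assume "a \<in> G \<longrightarrow> u t a \<ge> \<epsilon>"
    then show "ennreal (\<epsilon> powr (2 * p)) * indicator G a \<le> ennreal (\<bar>u t a\<bar> powr (2 * p))"
      using \<epsilon> p by (cases "a \<in> G") (auto intro!: ennreal_leI powr_mono2)
  qed
  finally have "ennreal (y powr (1 / p)) \<le> ennreal_powr (\<integral>\<^sup>+ a. ennreal (\<bar>u t a\<bar> powr (2 * p)) \<partial>P) (1 / p)"
    using y p by (intro ennreal_powr_lower_bound) auto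
  then have "ennreal (t powr (d / 2)) * ennreal (y powr (1 / p)) \<le> ennreal C"
    by (rule order_trans[OF mult_left_mono C[OF t]]) simp
  then have "t powr (d / 2) * y powr (1 / p) \<le> C"
    by (simp add: C_def ennreal_mult[symmetric])

  moreover have "t powr (d / 2) = (\<epsilon> / (4 * d)) powr (d / 2) * 2 powr (real n * (d / 2))"
    unfolding t_def using \<epsilon> d by (subst powr_mult) (auto simp: powr_powr)
  moreover have "y powr (1 / p) = \<epsilon> powr 2 * (2 powr (- real n / 2) * \<pi> powr (1 / p))"
  proof -
    have "- 2 * (q + 1) * real n * (1 / p) = - real n / 2" "2 * p * (1 / p) = 2"
      using q p by (simp_all add: p_def field_simps)
    then show ?thesis
      using \<epsilon> \<pi> unfolding y_def by (simp add: powr_mult powr_powr)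
  qed
  ultimately have "K * (2 powr (real n * (d / 2)) * 2 powr (- real n / 2)) \<le> C"
    by (simp add: K_def mult_ac)
  moreover have "2 powr real n \<le> 2 powr (real n * (d / 2)) * 2 powr (- real n / 2)"
  proof -
    have "real n * 3 \<le> real n * d" using d by (intro mult_left_mono) auto
    then have "real n \<le> real n * (d / 2) + - real n / 2" by simp
    then show ?thesis unfolding powr_add[symmetric] by (intro powr_mono) auto
  qed
  ultimately have "K * 2 powr real n \<le> C"
    using K by (meson less_imp_le mult_left_mono order_trans)
  then show False using n_large(1) K by (simp add: field_simps)
qed

end
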